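(* Let $\mathcal A$ and $\mathcal B$ be ideals of closed subsets of a space $X$. Then (i) $\mathsf G_1(\mathscr N_{\mathrm{MC}_{\mathcal A}(X),\mathbf 0} , \neg \Omega_{\mathrm{MC}_{\mathcal B}(X),\mathbf 0}) \leq_{\mathrm{II}} \mathsf G_1(\mathscr N_{\mathrm{MC}_{\mathcal A}(X),\mathbf 0} , \neg \Gamma_{\mathrm{MC}_{\mathcal B}(X),\mathbf 0})$; and (ii) $\mathsf G_1(\mathscr N_{\mathrm{MC}_{\mathcal A}(X),\mathbf 0} , \neg \Gamma_{\mathrm{MC}_{\mathcal B}(X),\mathbf 0}) \leq_{\mathrm{II}} \mathsf G_1(\mathscr N_X[\mathcal A], \neg \Gamma_X(\mathcal B))$.
   Context: Spaces and ideals. All spaces are Hausdorff. An ideal of closed sets of $X$ is a family $\mathcal A$ of non-empty closed subsets of $X$ such that $A\cup B\in\mathcal A$ for $A,B\in\mathcal A$; every non-empty closed subset of a member of $\mathcal A$ is in $\mathcal A$; and $\{x\}\in\mathcal A$ for every $x\in X$. Every ideal of closed sets is assumed not to contain $X$ itself. Minimal cusco maps. A cusco map $\Phi$ from $X$ to $\mathbb R$ assigns to each $x\in X$ a non-empty compact convex set $\Phi(x)\subseteq\mathbb R$ and is upper semicontinuous: $\{x\in X:\Phi(x)\subseteq V\}$ is open for every open $V\subseteq\mathbb R$. It is minimal if its graph $\{\langle x,y\rangle:y\in\Phi(x)\}$ is $\subseteq$-minimal among graphs of cusco maps from $X$ to $\mathbb R$. $\mathrm{MC}(X)$ is the set of all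 minimal cusco maps from $X$ to $\mathbb R$; $\mathbf 0\in \mathrm{MC}(X)$ is the map constantly $\{0\}$. For $A\subseteq X$ and $\varepsilon>0$, $\mathbf W(A,\varepsilon)$ is the set of pairs $\langle\Phi,\Psi\rangle$ such that for all $x\in A$, $\Phi(x)\subseteq\bigcup_{y\in\Psi(x)}B(y,\varepsilon)$ and $\Psi(x)\subseteq\bigcup_{y\in\Phi(x)}B(y,\varepsilon)$, where $B(y,\varepsilon)=(y-\varepsilon,y+\varepsilon)$. $\mathrm{MC}_{\mathcal A}(X)$ is $\mathrm{MC}(X)$ with the topology generated by the uniformity with base $\{\mathbf W(A,\varepsilon):A\in\mathcal A,\varepsilon>0\}$. Collections. For a space $Y$ and $y\in Y$: $\mathscr T_Y$ is the set of all proper non-empty open subsets of $Y$; $\mathscr N_{Y,y}=\{U\in\mathscr T_Y:y\in U\}$; $\mathscr N_Y(A)=\{U\in\mathscr T_Y:A\subseteq U\}$ for $A\subseteq Y$, and $\mathscr N_Y[\mathcal A]=\{\mathscr N_Y(A):A\in\mathcal A\}$; $\Omega_{Y,y}=\{A\subseteq Y:y\in\mathrm{cl}_Y(A)\}$; $\Gamma_{Y,y}$ is the collection of sequences in $Y$ converging to $y$; $\Gamma_Y(\mathcal B)$ is the collection of sequences $\langle U_n:n\in\omega\rangle$ of members of $\mathscr T_Y$ such that every $B\in\mathcal B$ satisfies $B\subseteq U_n$ for all but finitely many $n$. $\neg\mathcal D$ is the collection of objects not in $\mathcal D$. Games. In $\mathsf G_1(\mathcal C,\mathcal D)$, in inning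 $n\in\omega$ One plays $A_n\in\mathcal C$ and Two responds with $x_n\in A_n$; Two wins if $\{x_n:n\in\omega\}\in\mathcal D$, otherwise One wins (when $\mathcal D=\neg\Gamma_{Y,y}$ or $\neg\Gamma_Y(\mathcal B)$, membership is evaluated for the sequence $\langle x_n:n\in\omega\rangle$). $\mathrm I\uparrow\mathcal G$ (resp. $\mathrm{II}\uparrow\mathcal G$): One (resp. Two) has a winning strategy, where strategies may depend on all previous moves of the opponent (for Two, including the current one). $\mathrm I\uparrow_{\mathrm{pre}}\mathcal G$: One has a winning predetermined strategy, i.e. one depending only on $n$. $\mathrm{II}\uparrow_{\mathrm{mark}}\mathcal G$: Two has a winning Markov strategy, i.e. one depending only on One's current move and $n$. A slashed arrow denotes negation. $\mathcal G\leq_{\mathrm{II}}\mathcal H$ means that all four implications hold: $\mathrm{II}\uparrow_{\mathrm{mark}}\mathcal G\Rightarrow\mathrm{II}\uparrow_{\mathrm{mark}}\mathcal H$; $\mathrm{II}\uparrow\mathcal G\Rightarrow\mathrm{II}\uparrow\mathcal H$; $\mathrm I\not\uparrow\mathcal G\Rightarrow\mathrm I\not\uparrow\mathcal H$; $\mathrm I\not\uparrow_{\mathrm{pre}}\mathcal G\Rightarrow\mathrm I\not\uparrow_{\mathrm{pre}}\mathcal H$. *)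

theory Defs
  imports "HOL-Analysis.Analysis"
begin

section \<open>Ideals of closed sets\<close>

definition ideal_of_closed_sets :: "'a topology \<Rightarrow> 'a set set \<Rightarrow> bool" where
  "ideal_of_closed_sets X \<A> \<longleftrightarrow>
     (\<forall>A\<in>\<A>. A \<noteq> {} \<and> closedin X A) \<and>
     (\<forall>A\<in>\<A>. \<forall>B\<in>\<A>. A \<union> B \<in> \<A>) \<and>
     (\<forall>A\<in>\<A>. \<forall>B. B \<noteq> {} \<and> closedin X B \<and> B \<subseteq> A \<longrightarrow> B \<in> \<A>) \<and>
     (\<forall>x\<in>topspace X. {x} \<in> \<A>) \<and>
     topspace X \<notin> \<A>"


section \<open>Minimal cusco maps\<close>

text \<open>A set-valued map on \<open>X\<close> is a function that is extensional on \<open>topspace X\<close>, so that maps which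
  agree on the points of \<open>X\<close> are equal.\<close>

definition cusco_map :: "'a topology \<Rightarrow> ('a \<Rightarrow> real set) \<Rightarrow> bool" where
  "cusco_map X \<Phi> \<longleftrightarrow>
     \<Phi> \<in> extensional (topspace X) \<and>
     (\<forall>x\<in>topspace X. \<Phi> x \<noteq> {} \<and> compact (\<Phi> x) \<and> convex (\<Phi> x)) \<and>
     (\<forall>V. open V \<longrightarrow> openin X {x \<in> topspace X. \<Phi> x \<subseteq> V})"

definition map_graph :: "'a topology \<Rightarrow> ('a \<Rightarrow> real set) \<Rightarrow> ('a \<times> real) set" where
  "map_graph X \<Phi> = {(x, y). x \<in> topspace X \<and> y \<in> \<Phi> x}"

definition MC :: "'a topology \<Rightarrow> ('a \<Rightarrow> real set) set" where
  "MC X = {\<Phi>. cusco_map X \<Phi> \<and>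
     (\<forall>\<Psi>. cusco_map X \<Psi> \<and> map_graph X \<Psi> \<subseteq> map_graph X \<Phi> \<longrightarrow> map_graph X \<Psi> = map_graph X \<Phi>)}"

definition zero_map :: "'a topology \<Rightarrow> 'a \<Rightarrow> real set" where
  "zero_map X = (\<lambda>x\<in>topspace X. {0})"

lemma zero_map_in_MC: "zero_map X \<in> MC X"
proof -
  have "openin X {x \<in> topspace X. zero_map X x \<subseteq> V}" for V
    by (cases "0 \<in> V") (auto simp: zero_map_def cong: conj_cong)
  then have "cusco_map X (zero_map X)"
    by (auto simp: cusco_map_def zero_map_def)
  moreover have "map_graph X \<Psi> = map_graph X (zero_map X)"
    if "cusco_map X \<Psi>" "map_graph X \<Psi> \<subseteq> map_graph X (zero_map X)" for \<Psi>
  proof -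
    have "\<Psi> x = {0}" if "x \<in> topspace X" for x
      using that \<open>cusco_map X \<Psi>\<close> \<open>map_graph X \<Psi> \<subseteq> _\<close>
      by (fastforce simp: cusco_map_def map_graph_def zero_map_def)
    then show ?thesis
      by (auto simp: map_graph_def zero_map_def)
  qed
  ultimately show ?thesis
    by (auto simp: MC_def)
qed

definition MC_entourage ::
  "'a topology \<Rightarrow> 'a set \<Rightarrow> real \<Rightarrow> (('a \<Rightarrow> real set) \<times> ('a \<Rightarrow> real set)) set" where
  "MC_entourage X A \<epsilon> = {(\<Phi>, \<Psi>). \<Phi> \<in> MC X \<and> \<Psi> \<in> MC X \<and>
     (\<forall>x\<in>A. \<Phi> x \<subseteq> (\<Union>y\<in>\<Psi> x. ball y \<epsilon>) \<and> \<Psi> x \<subseteq> (\<Union>y\<in>\<Phi> x. ball y \<epsilon>))}"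

text \<open>The term \<open>principal (MC X \<times> MC X)\<close> only has an effect if \<open>\<A>\<close> is empty, which for an ideal of
  closed sets means that \<open>X\<close> is the empty space.\<close>

definition MC_uniformity ::
  "'a topology \<Rightarrow> 'a set set \<Rightarrow> (('a \<Rightarrow> real set) \<times> ('a \<Rightarrow> real set)) filter" where
  "MC_uniformity X \<A> = inf (principal (MC X \<times> MC X))
     (INF (A, \<epsilon>)\<in>\<A> \<times> {0<..}. principal (MC_entourage X A \<epsilon>))"

text \<open>The topology of a uniformity is expressed as in the axiom \<open>open_uniformity\<close> of the class
  \<open>uniform_space\<close>.\<close>

definition MC_space :: "'a topology \<Rightarrow> 'a set set \<Rightarrow> ('a \<Rightarrow> real set) topology" where
  "MC_space X \<A> = topology (\<lambda>U. U \<subseteq> MC X \<and>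
     (\<forall>\<Phi>\<in>U. \<forall>\<^sub>F (\<Phi>', \<Psi>) in MC_uniformity X \<A>. \<Phi>' = \<Phi> \<longrightarrow> \<Psi> \<in> U))"

lemma openin_MC_space:
  "openin (MC_space X \<A>) U \<longleftrightarrow> U \<subseteq> MC X \<and>
     (\<forall>\<Phi>\<in>U. \<forall>\<^sub>F (\<Phi>', \<Psi>) in MC_uniformity X \<A>. \<Phi>' = \<Phi> \<longrightarrow> \<Psi> \<in> U)"
proof -
  have "istopology (\<lambda>U. U \<subseteq> MC X \<and>
     (\<forall>\<Phi>\<in>U. \<forall>\<^sub>F (\<Phi>', \<Psi>) in MC_uniformity X \<A>. \<Phi>' = \<Phi> \<longrightarrow> \<Psi> \<in> U))"
    unfolding istopology_def
  proof (intro conjI allI impI ballI)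
    fix S T \<Phi>
    assume "S \<subseteq> MC X \<and> (\<forall>\<Phi>\<in>S. \<forall>\<^sub>F (\<Phi>', \<Psi>) in MC_uniformity X \<A>. \<Phi>' = \<Phi> \<longrightarrow> \<Psi> \<in> S)"
      and "T \<subseteq> MC X \<and> (\<forall>\<Phi>\<in>T. \<forall>\<^sub>F (\<Phi>', \<Psi>) in MC_uniformity X \<A>. \<Phi>' = \<Phi> \<longrightarrow> \<Psi> \<in> T)"
      and "\<Phi> \<in> S \<inter> T"
    then have "\<forall>\<^sub>F (\<Phi>', \<Psi>) in MC_uniformity X \<A>. \<Phi>' = \<Phi> \<longrightarrow> \<Psi> \<in> S"
      and "\<forall>\<^sub>F (\<Phi>', \<Psi>) in MC_uniformity X \<A>. \<Phi>' = \<Phi> \<longrightarrow> \<Psi> \<in> T"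
      by auto
    then show "\<forall>\<^sub>F (\<Phi>', \<Psi>) in MC_uniformity X \<A>. \<Phi>' = \<Phi> \<longrightarrow> \<Psi> \<in> S \<inter> T"
      by eventually_elim auto
  next
    fix \<U> \<Phi>
    assume *: "\<forall>U\<in>\<U>. U \<subseteq> MC X \<and>
        (\<forall>\<Phi>\<in>U. \<forall>\<^sub>F (\<Phi>', \<Psi>) in MC_uniformity X \<A>. \<Phi>' = \<Phi> \<longrightarrow> \<Psi> \<in> U)"
      and "\<Phi> \<in> \<Union>\<U>"
    then obtain U where U: "U \<in> \<U>" "\<Phi> \<in> U" by auto
    with * have "\<forall>\<^sub>F (\<Phi>', \<Psi>) in MC_uniformity X \<A>. \<Phi>' = \<Phi> \<longrightarrow> \<Psi> \<in> U"
      by auto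
    then show "\<forall>\<^sub>F (\<Phi>', \<Psi>) in MC_uniformity X \<A>. \<Phi>' = \<Phi> \<longrightarrow> \<Psi> \<in> \<Union>\<U>"
      by eventually_elim (use U in auto)
  qed auto
  then show ?thesis
    by (simp add: MC_space_def topology_inverse')
qed

lemma topspace_MC_space [simp]: "topspace (MC_space X \<A>) = MC X"
proof -
  have "\<forall>\<^sub>F (\<Phi>', \<Psi>) in MC_uniformity X \<A>. \<Phi>' = \<Phi> \<longrightarrow> \<Psi> \<in> MC X" for \<Phi>
    unfolding MC_uniformity_def inf_commute[of "principal _"] eventually_inf_principal
    by (rule always_eventually) auto
  then have "openin (MC_space X \<A>) (MC X)"
    by (auto simp: openin_MC_space)
  then show ?thesis
    by (meson openin_MC_space openin_subset openin_topspace subset_antisym)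
qed

lemma eventually_MC_uniformity:
  assumes "ideal_of_closed_sets X \<A>" "topspace X \<noteq> {}"
  shows "eventually P (MC_uniformity X \<A>) \<longleftrightarrow>
    (\<exists>A\<in>\<A>. \<exists>\<epsilon>>0. \<forall>p\<in>MC_entourage X A \<epsilon>. P p)"
proof -
  let ?F = "\<lambda>p. principal (MC_entourage X (fst p) (snd p))"
  have ne: "\<A> \<times> {0<..} \<noteq> ({} :: ('a set \<times> real) set)"
    using assms unfolding ideal_of_closed_sets_def by (auto simp: ex_in_conv)
  have dir: "\<exists>r\<in>\<A> \<times> {0<..}. ?F r \<le> inf (?F p) (?F q)"
    if "p \<in> \<A> \<times> {0<..}" "q \<in> \<A> \<times> {0<..}" for p q :: "'a set \<times> real"
  proof
    show "(fst p \<union> fst q, min (snd p) (snd q)) \<in> \<A> \<times> {0<..}"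
      using that assms unfolding ideal_of_closed_sets_def by auto
    show "?F (fst p \<union> fst q, min (snd p) (snd q)) \<le> inf (?F p) (?F q)"
      unfolding MC_entourage_def by (fastforce simp: subset_iff)
  qed
  have sub: "MC_entourage X A \<epsilon> \<subseteq> MC X \<times> MC X" for A \<epsilon>
    unfolding MC_entourage_def by auto
  have "eventually P (MC_uniformity X \<A>) \<longleftrightarrow>
      (\<exists>p\<in>\<A> \<times> {0<..}. eventually (\<lambda>q. q \<in> MC X \<times> MC X \<longrightarrow> P q) (?F p))"
    unfolding MC_uniformity_def inf_commute[of "principal _"] eventually_inf_principal case_prod_unfold
    by (subst eventually_INF_base[OF ne dir]) simp_all
  also have "\<dots> \<longleftrightarrow> (\<exists>A\<in>\<A>. \<exists>\<epsilon>>0. \<forall>p\<in>MC_entourage X A \<epsilon>. P p)"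
    using sub by (fastforce simp: eventually_principal)
  finally show ?thesis .
qed


section \<open>Collections of open sets and of points\<close>

definition proper_opens :: "'b topology \<Rightarrow> 'b set set" where
  "proper_opens Y = {U. openin Y U \<and> U \<noteq> {} \<and> U \<noteq> topspace Y}"

definition nbhds_pt :: "'b topology \<Rightarrow> 'b \<Rightarrow> 'b set set" where
  "nbhds_pt Y y = {U \<in> proper_opens Y. y \<in> U}"

definition nbhds_set :: "'b topology \<Rightarrow> 'b set \<Rightarrow> 'b set set" where
  "nbhds_set Y A = {U \<in> proper_opens Y. A \<subseteq> U}"

definition nbhds_family :: "'b topology \<Rightarrow> 'b set set \<Rightarrow> 'b set set set" where
  "nbhds_family Y \<A> = nbhds_set Y ` \<A>"

definition Omega_pt :: "'b topology \<Rightarrow> 'b \<Rightarrow> 'b set set" where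
  "Omega_pt Y y = {A. A \<subseteq> topspace Y \<and> y \<in> Y closure_of A}"

definition Gamma_pt :: "'b topology \<Rightarrow> 'b \<Rightarrow> (nat \<Rightarrow> 'b) set" where
  "Gamma_pt Y y = {s. range s \<subseteq> topspace Y \<and> limitin Y s y sequentially}"

definition Gamma_cover :: "'b topology \<Rightarrow> 'b set set \<Rightarrow> (nat \<Rightarrow> 'b set) set" where
  "Gamma_cover Y \<B> = {U. range U \<subseteq> proper_opens Y \<and> (\<forall>B\<in>\<B>. \<forall>\<^sub>F n in sequentially. B \<subseteq> U n)}"


section \<open>Single-selection games\<close>

text \<open>A game consists of the family of sets One may play and the set of those sequences of choices
  with which Two wins.\<close>

type_synonym 'x game = "'x set set \<times> (nat \<Rightarrow> 'x) set"

definition G1 :: "'x set set \<Rightarrow> 'x set set \<Rightarrow> 'x game" where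
  "G1 \<C> \<D> = (\<C>, {s. range s \<in> \<D>})"

definition G1_seq :: "'x set set \<Rightarrow> (nat \<Rightarrow> 'x) set \<Rightarrow> 'x game" where
  "G1_seq \<C> \<D> = (\<C>, \<D>)"

text \<open>A strategy of One sees the list of Two's previous choices, oldest first. A strategy of Two sees
  the non-empty list of One's moves, oldest first and ending with the current one.\<close>

fun One_wins :: "'x game \<Rightarrow> bool" where
  "One_wins (\<C>, W) \<longleftrightarrow> (\<exists>\<sigma> :: 'x list \<Rightarrow> 'x set.
     (\<forall>xs. \<sigma> xs \<in> \<C>) \<and>
     (\<forall>s. (\<forall>n. s n \<in> \<sigma> (map s [0..<n])) \<longrightarrow> s \<notin> W))"

fun One_wins_pre :: "'x game \<Rightarrow> bool" where
  "One_wins_pre (\<C>, W) \<longleftrightarrow> (\<exists>\<sigma> :: nat \<Rightarrow> 'x set.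
     (\<forall>n. \<sigma> n \<in> \<C>) \<and>
     (\<forall>s. (\<forall>n. s n \<in> \<sigma> n) \<longrightarrow> s \<notin> W))"

fun Two_wins :: "'x game \<Rightarrow> bool" where
  "Two_wins (\<C>, W) \<longleftrightarrow> (\<exists>\<tau> :: 'x set list \<Rightarrow> 'x.
     (\<forall>As. As \<noteq> [] \<and> set As \<subseteq> \<C> \<longrightarrow> \<tau> As \<in> last As) \<and>
     (\<forall>A. (\<forall>n. A n \<in> \<C>) \<longrightarrow> (\<lambda>n. \<tau> (map A [0..<Suc n])) \<in> W))"

fun Two_wins_mark :: "'x game \<Rightarrow> bool" where
  "Two_wins_mark (\<C>, W) \<longleftrightarrow> (\<exists>\<tau> :: 'x set \<Rightarrow> nat \<Rightarrow> 'x.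
     (\<forall>A\<in>\<C>. \<forall>n. \<tau> A n \<in> A) \<and>
     (\<forall>A. (\<forall>n. A n \<in> \<C>) \<longrightarrow> (\<lambda>n. \<tau> (A n) n) \<in> W))"

definition game_le_II :: "'x game \<Rightarrow> 'y game \<Rightarrow> bool"  (infix "\<le>\<^sub>I\<^sub>I" 50) where
  "G \<le>\<^sub>I\<^sub>I H \<longleftrightarrow>
     (Two_wins_mark G \<longrightarrow> Two_wins_mark H) \<and>
     (Two_wins G \<longrightarrow> Two_wins H) \<and>
     (\<not> One_wins G \<longrightarrow> \<not> One_wins H) \<and>
     (\<not> One_wins_pre G \<longrightarrow> \<not> One_wins_pre H)"

end

theory Submission
  imports Defs
begin

text \<open>Both comparisons follow from one translation principle for selection games. Suppose that in
  every inning \<open>n\<close> a move \<open>B\<close> of One in the game \<open>H\<close> can be turned into a move \<open>t1 n B\<close> of One in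
  the game \<open>G\<close>, and every answer \<open>x \<in> t1 n B\<close> of Two back into an answer \<open>t2 n B x \<in> B\<close>, in such a
  way that plays won by Two in \<open>G\<close> become plays won by Two in \<open>H\<close>. Then Two can play \<open>H\<close> by playing \<open>G\<close>
  on the side, and so can One play \<open>G\<close> by playing \<open>H\<close> on the side
  (lemma \<open>game_le_II_translation\<close>).

  For the first comparison the translations are identities: a sequence converging to \<open>\<^bold>0\<close> has
  \<open>\<^bold>0\<close> in the closure of its range, so Two wins the \<open>\<Gamma>\<close> game whenever Two wins the \<open>\<Omega>\<close> game.

  For the second comparison, a move \<open>\<N>\<^sub>X(A)\<close> of One is turned into the neighbourhood of \<open>\<^bold>0\<close> of all
  \<open>\<Phi>\<close> that stay within a distance less than \<open>2\<^sup>-\<^sup>n\<close> of \<open>0\<close> on \<open>A\<close>. An answer \<open>\<Phi>\<close> is turned into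
  \<open>U = {x. \<Phi> x \<subseteq> (-2\<^sup>-\<^sup>n, 2\<^sup>-\<^sup>n)}\<close>, which is open by upper semicontinuity and contains \<open>A\<close>. If the sets
  \<open>U\<^sub>n\<close> so obtained eventually contain each \<open>B \<in> \<B>\<close>, then the maps \<open>\<Phi>\<^sub>n\<close> converge to \<open>\<^bold>0\<close>
  uniformly on each \<open>B\<close>, because \<open>2\<^sup>-\<^sup>n\<close> tends to \<open>0\<close>. The set \<open>U\<close> may be the whole space, which Two
  must not play; then any proper open superset of \<open>A\<close> will do, since such an inning is harmless for
  the convergence of the \<open>\<Phi>\<^sub>n\<close>.\<close>

section \<open>Translating strategies between selection games\<close>

text \<open>The moves of Two in the second game that correspond to a list of moves of Two in the first
  one, when One follows \<open>\<sigma>\<close> in the second game. Each translated move depends on the move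
  of One that it answers, hence on all earlier translated moves.\<close>

definition translated_history ::
  "(nat \<Rightarrow> 'y set \<Rightarrow> 'x \<Rightarrow> 'y) \<Rightarrow> ('y list \<Rightarrow> 'y set) \<Rightarrow> 'x list \<Rightarrow> 'y list" where
  "translated_history t \<sigma> = foldl (\<lambda>ys x. ys @ [t (length ys) (\<sigma> ys) x]) []"

lemma translated_history_Nil [simp]: "translated_history t \<sigma> [] = []"
  by (simp add: translated_history_def)

lemma translated_history_snoc:
  "translated_history t \<sigma> (xs @ [x]) = translated_history t \<sigma> xs @
     [t (length (translated_history t \<sigma> xs)) (\<sigma> (translated_history t \<sigma> xs)) x]"
  by (simp add: translated_history_def)

lemma length_translated_history [simp]: "length (translated_history t \<sigma> xs) = length xs"
  by (induction xs rule: rev_induct) (simp_all add: translated_history_snoc)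

lemma translated_history_upt:
  "translated_history t \<sigma> (map s [0..<n]) =
     map (\<lambda>k. t k (\<sigma> (translated_history t \<sigma> (map s [0..<k]))) (s k)) [0..<n]"
  by (induction n) (simp_all add: translated_history_snoc)

text \<open>In each of the four parts a player moves in one of the games by consulting the given strategy
  for the other game, where the opponent's moves are simulated: moves of One are carried from
  \<open>(D, V)\<close> to \<open>(C, W)\<close> by \<open>t1\<close>, and moves of Two are carried back by \<open>t2\<close>.\<close>

lemma game_le_II_translation:
  fixes C :: "'x set set" and D :: "'y set set"
  assumes t1: "\<And>n B. B \<in> D \<Longrightarrow> t1 n B \<in> C"
    and t2: "\<And>n B x. B \<in> D \<Longrightarrow> x \<in> t1 n B \<Longrightarrow> t2 n B x \<in> B"
    and win: "\<And>B x. (\<And>n. B n \<in> D) \<Longrightarrow> (\<And>n. x n \<in> t1 n (B n)) \<Longrightarrow> x \<in> W \<Longrightarrow>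
      (\<lambda>n. t2 n (B n) (x n)) \<in> V"
  shows "(C, W) \<le>\<^sub>I\<^sub>I (D, V)"
  unfolding game_le_II_def
proof (intro conjI impI)
  assume "Two_wins_mark (C, W)"
  then obtain \<tau> where legal: "\<And>A n. A \<in> C \<Longrightarrow> \<tau> A n \<in> A"
    and wins: "\<And>A. (\<And>n. A n \<in> C) \<Longrightarrow> (\<lambda>n. \<tau> (A n) n) \<in> W"
    by auto
  have "(\<lambda>n. t2 n (B n) (\<tau> (t1 n (B n)) n)) \<in> V" if "\<And>n. B n \<in> D" for B
    using that t1 legal by (intro win wins) auto
  moreover have "t2 n B (\<tau> (t1 n B) n) \<in> B" if "B \<in> D" for B n
    using that t1 legal by (intro t2) auto
  ultimately show "Two_wins_mark (D, V)"
    by (auto intro!: exI[of _ "\<lambda>B n. t2 n B (\<tau> (t1 n B) n)"])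
next
  assume "Two_wins (C, W)"
  then obtain \<tau> where legal: "\<And>As. As \<noteq> [] \<Longrightarrow> set As \<subseteq> C \<Longrightarrow> \<tau> As \<in> last As"
    and wins: "\<And>A. (\<And>n. A n \<in> C) \<Longrightarrow> (\<lambda>n. \<tau> (map A [0..<Suc n])) \<in> W"
    by auto
  define tr where "tr Bs = map (\<lambda>k. t1 k (Bs ! k)) [0..<length Bs]" for Bs
  define \<tau>' where "\<tau>' Bs = t2 (length Bs - 1) (last Bs) (\<tau> (tr Bs))" for Bs
  have tr_map: "tr (map B [0..<Suc n]) = map (\<lambda>k. t1 k (B k)) [0..<Suc n]" for B n
    unfolding tr_def by (rule map_cong) (auto simp: nth_append less_Suc_eq)
  have tr_legal: "\<tau> (tr Bs) \<in> t1 (length Bs - 1) (last Bs)" if "Bs \<noteq> []" "set Bs \<subseteq> D" for Bs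
  proof -
    have "last (tr Bs) = t1 (length Bs - 1) (last Bs)"
      using that by (simp add: tr_def last_map last_conv_nth)
    moreover have "set (tr Bs) \<subseteq> C"
      using that t1 by (auto simp: tr_def subset_iff)
    ultimately show ?thesis
      using legal[of "tr Bs"] that by (simp add: tr_def)
  qed
  have "\<tau>' Bs \<in> last Bs" if "Bs \<noteq> []" "set Bs \<subseteq> D" for Bs
    unfolding \<tau>'_def using that by (intro t2 tr_legal) (auto simp: subset_iff)
  moreover have "(\<lambda>n. \<tau>' (map B [0..<Suc n])) \<in> V" if B: "\<And>n. B n \<in> D" for B
  proof -
    let ?x = "\<lambda>n. \<tau> (map (\<lambda>k. t1 k (B k)) [0..<Suc n])"
    have "?x n \<in> t1 n (B n)" for n
      using tr_legal[of "map B [0..<Suc n]"] B unfolding tr_map by auto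
    moreover have "?x \<in> W"
      using B t1 by (intro wins) auto
    ultimately have "(\<lambda>n. t2 n (B n) (?x n)) \<in> V"
      using B by (intro win) auto
    then show ?thesis
      unfolding \<tau>'_def tr_map by simp
  qed
  ultimately show "Two_wins (D, V)"
    unfolding Two_wins.simps by blast
next
  assume no_win: "\<not> One_wins (C, W)"
  show "\<not> One_wins (D, V)"
  proof
    assume "One_wins (D, V)"
    then obtain \<sigma> where legal: "\<And>ys. \<sigma> ys \<in> D"
      and wins: "\<And>s. (\<And>n. s n \<in> \<sigma> (map s [0..<n])) \<Longrightarrow> s \<notin> V"
      by auto
    let ?h = "translated_history t2 \<sigma>"
    have "s \<notin> W" if s: "\<And>n. s n \<in> t1 n (\<sigma> (?h (map s [0..<n])))" for s
    proof
      assume "s \<in> W"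
      let ?y = "\<lambda>n. t2 n (\<sigma> (?h (map s [0..<n]))) (s n)"
      have "?y \<in> V"
        using legal s \<open>s \<in> W\<close> by (rule win)
      moreover have "?y \<notin> V"
        using wins[of ?y] t2[OF legal s] by (simp add: translated_history_upt[symmetric])
      ultimately show False
        by contradiction
    qed
    then have "One_wins (C, W)"
      using t1 legal by (auto intro!: exI[of _ "\<lambda>xs. t1 (length xs) (\<sigma> (?h xs))"])
    then show False
      using no_win by contradiction
  qed
next
  assume no_win: "\<not> One_wins_pre (C, W)"
  show "\<not> One_wins_pre (D, V)"
  proof
    assume "One_wins_pre (D, V)"
    then obtain \<sigma> where legal: "\<And>n. \<sigma> n \<in> D"
      and wins: "\<And>s. (\<And>n. s n \<in> \<sigma> n) \<Longrightarrow> s \<notin> V"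
      by auto
    have "s \<notin> W" if s: "\<And>n. s n \<in> t1 n (\<sigma> n)" for s
      using win[OF legal s] wins[OF t2[OF legal s]] by blast
    then have "One_wins_pre (C, W)"
      using t1 legal by (auto intro!: exI[of _ "\<lambda>n. t1 n (\<sigma> n)"])
    then show False
      using no_win by contradiction
  qed
qed

lemma game_le_II_mono: "W \<subseteq> V \<Longrightarrow> (C, W) \<le>\<^sub>I\<^sub>I (C, V)"
  by (rule game_le_II_translation[where ?t1.0 = "\<lambda>_ A. A" and ?t2.0 = "\<lambda>_ _ x. x"]) auto


section \<open>Neighbourhoods of the zero map\<close>

lemma constant_map_in_MC: "(\<lambda>x\<in>topspace X. {c}) \<in> MC X"
proof -
  have "openin X {x \<in> topspace X. (\<lambda>x\<in>topspace X. {c}) x \<subseteq> V}" for V :: "real set"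
    by (cases "c \<in> V") (auto cong: conj_cong)
  then have "cusco_map X (\<lambda>x\<in>topspace X. {c})"
    by (auto simp: cusco_map_def)
  moreover have "map_graph X \<Psi> = map_graph X (\<lambda>x\<in>topspace X. {c})"
    if "cusco_map X \<Psi>" "map_graph X \<Psi> \<subseteq> map_graph X (\<lambda>x\<in>topspace X. {c})" for \<Psi>
    \<comment> \<open>The values of a cusco map are non-empty, so none of them can lie properly inside \<open>{c}\<close>.\<close>
  proof -
    have "\<Psi> x = {c}" if "x \<in> topspace X" for x
      using that \<open>cusco_map X \<Psi>\<close> \<open>map_graph X \<Psi> \<subseteq> _\<close>
      by (fastforce simp: cusco_map_def map_graph_def)
    then show ?thesis
      by (auto simp: map_graph_def)
  qed
  ultimately show ?thesis
    by (auto simp: MC_def)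
qed

text \<open>The maps that stay away from the endpoints of \<open>(-\<epsilon>, \<epsilon>)\<close> uniformly on \<open>A\<close>. The room left
  by \<open>\<delta> < \<epsilon>\<close> is what makes this set open: on an infinite \<open>A\<close>, a map with values in \<open>(-\<epsilon>, \<epsilon>)\<close>
  may approach the endpoints.\<close>

definition zero_nbhd :: "'a topology \<Rightarrow> 'a set \<Rightarrow> real \<Rightarrow> ('a \<Rightarrow> real set) set" where
  "zero_nbhd X A \<epsilon> = {\<Phi> \<in> MC X. \<exists>\<delta><\<epsilon>. \<forall>x\<in>A. \<Phi> x \<subseteq> ball 0 \<delta>}"

lemma openin_zero_nbhd:
  assumes "ideal_of_closed_sets X \<A>" "A \<in> \<A>"
  shows "openin (MC_space X \<A>) (zero_nbhd X A \<epsilon>)"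
  unfolding openin_MC_space
proof (intro conjI ballI)
  show "zero_nbhd X A \<epsilon> \<subseteq> MC X"
    by (auto simp: zero_nbhd_def)
  fix \<Phi> assume "\<Phi> \<in> zero_nbhd X A \<epsilon>"
  then obtain \<delta> where \<delta>: "\<delta> < \<epsilon>" "\<And>x. x \<in> A \<Longrightarrow> \<Phi> x \<subseteq> ball 0 \<delta>"
    by (auto simp: zero_nbhd_def)
  define \<eta> where "\<eta> = (\<epsilon> - \<delta>) / 2"
  have \<eta>: "\<eta> > 0" "\<delta> + \<eta> < \<epsilon>"
    using \<delta>(1) by (auto simp: \<eta>_def field_simps)
  have "\<Psi> \<in> zero_nbhd X A \<epsilon>" if "(\<Phi>, \<Psi>) \<in> MC_entourage X A \<eta>" for \<Psi>
  proof -
    have "\<Psi> x \<subseteq> ball 0 (\<delta> + \<eta>)" if "x \<in> A" for x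
    proof
      fix z assume "z \<in> \<Psi> x"
      then obtain y where "y \<in> \<Phi> x" "dist y z < \<eta>"
        using \<open>(\<Phi>, \<Psi>) \<in> _\<close> \<open>x \<in> A\<close> by (fastforce simp: MC_entourage_def)
      then show "z \<in> ball 0 (\<delta> + \<eta>)"
        using \<delta>(2)[OF \<open>x \<in> A\<close>] dist_triangle[of 0 z y] by (fastforce simp: subset_iff)
    qed
    then show ?thesis
      using that \<eta>(2) by (auto simp: MC_entourage_def zero_nbhd_def)
  qed
  moreover have "topspace X \<noteq> {}"
    using assms by (fastforce simp: ideal_of_closed_sets_def closedin_def)
  ultimately show "\<forall>\<^sub>F (\<Phi>', \<Psi>) in MC_uniformity X \<A>. \<Phi>' = \<Phi> \<longrightarrow> \<Psi> \<in> zero_nbhd X A \<epsilon>"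
    using assms(2) \<eta>(1) by (subst eventually_MC_uniformity[OF assms(1)]) fastforce+
qed

text \<open>The constant map with value \<open>\<epsilon>\<close> shows that these neighbourhoods are proper.\<close>

lemma zero_nbhd_in_nbhds_pt:
  assumes "ideal_of_closed_sets X \<A>" "A \<in> \<A>" "\<epsilon> > 0"
  shows "zero_nbhd X A \<epsilon> \<in> nbhds_pt (MC_space X \<A>) (zero_map X)"
proof -
  have A: "A \<noteq> {}" "A \<subseteq> topspace X"
    using assms by (auto simp: ideal_of_closed_sets_def closedin_def)
  have zero: "zero_map X \<in> zero_nbhd X A \<epsilon>"
    using A zero_map_in_MC assms(3) by (auto simp: zero_nbhd_def zero_map_def intro!: exI[of _ "\<epsilon> / 2"])
  have "(\<lambda>x\<in>topspace X. {\<epsilon>}) \<notin> zero_nbhd X A \<epsilon>"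
    using A by (fastforce simp: zero_nbhd_def)
  then have "zero_nbhd X A \<epsilon> \<noteq> MC X"
    using constant_map_in_MC by metis
  then show ?thesis
    using zero openin_zero_nbhd[OF assms(1,2)] by (auto simp: nbhds_pt_def proper_opens_def)
qed

text \<open>Closeness to the zero map is one-sided: if a non-empty set lies within \<open>\<epsilon>\<close> of \<open>0\<close>, then also
  \<open>0\<close> lies within \<open>\<epsilon>\<close> of one of its points.\<close>

lemma zero_map_MC_entourage_iff:
  assumes "B \<subseteq> topspace X"
  shows "(zero_map X, \<Phi>) \<in> MC_entourage X B \<epsilon> \<longleftrightarrow> \<Phi> \<in> MC X \<and> (\<forall>x\<in>B. \<Phi> x \<subseteq> ball 0 \<epsilon>)"
proof -
  have "0 \<in> (\<Union>y\<in>\<Phi> x. ball y \<epsilon>)" if "\<Phi> \<in> MC X" "\<Phi> x \<subseteq> ball 0 \<epsilon>" "x \<in> B" for x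
  proof -
    have "\<Phi> x \<noteq> {}"
      using that assms by (auto simp: MC_def cusco_map_def)
    then show ?thesis
      using that by (force simp: dist_commute)
  qed
  then show ?thesis
    using assms zero_map_in_MC[of X] by (auto simp: MC_entourage_def zero_map_def subset_iff)
qed

lemma limitin_zero_mapI:
  assumes \<B>: "ideal_of_closed_sets X \<B>" and ne: "topspace X \<noteq> {}"
    and s: "\<And>n. s n \<in> MC X"
    and conv: "\<And>B \<epsilon>. B \<in> \<B> \<Longrightarrow> \<epsilon> > 0 \<Longrightarrow> \<forall>\<^sub>F n in F. \<forall>x\<in>B. s n x \<subseteq> ball 0 \<epsilon>"
  shows "limitin (MC_space X \<B>) s (zero_map X) F"
  unfolding limitin_def
proof (intro conjI allI impI)
  show "zero_map X \<in> topspace (MC_space X \<B>)"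
    by (simp add: zero_map_in_MC)
  fix U assume U: "openin (MC_space X \<B>) U \<and> zero_map X \<in> U"
  then have "\<forall>\<^sub>F (\<Phi>', \<Psi>) in MC_uniformity X \<B>. \<Phi>' = zero_map X \<longrightarrow> \<Psi> \<in> U"
    by (simp add: openin_MC_space)
  then obtain B \<epsilon> where B: "B \<in> \<B>" "\<epsilon> > 0"
    and sub: "\<And>\<Psi>. (zero_map X, \<Psi>) \<in> MC_entourage X B \<epsilon> \<Longrightarrow> \<Psi> \<in> U"
    unfolding eventually_MC_uniformity[OF \<B> ne] by fastforce
  have "B \<subseteq> topspace X"
    using \<B> B(1) by (auto simp: ideal_of_closed_sets_def closedin_def)
  then have "s n \<in> U" if "\<forall>x\<in>B. s n x \<subseteq> ball 0 \<epsilon>" for n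
    using that s by (intro sub) (simp add: zero_map_MC_entourage_iff)
  with conv[OF B] show "\<forall>\<^sub>F n in F. s n \<in> U"
    by (rule eventually_mono)
qed


section \<open>Translating maps into open sets\<close>

text \<open>This is where it matters that an ideal does not contain the whole space: a point outside \<open>A\<close>
  can be removed.\<close>

lemma nbhds_set_nonempty:
  assumes "t1_space X" "ideal_of_closed_sets X \<A>" "A \<in> \<A>"
  shows "nbhds_set X A \<noteq> {}"
proof -
  have A: "A \<noteq> {}" "A \<subseteq> topspace X" "A \<noteq> topspace X"
    using assms(2,3) by (auto simp: ideal_of_closed_sets_def closedin_def)
  then obtain x where x: "x \<in> topspace X" "x \<notin> A"
    by blast
  then have "openin X (topspace X - {x})"
    using assms(1) by (simp add: closedin_t1_singleton openin_diff)
  then have "topspace X - {x} \<in> nbhds_set X A"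
    using A x by (auto simp: nbhds_set_def proper_opens_def)
  then show ?thesis
    by blast
qed

definition small_values :: "'a topology \<Rightarrow> ('a \<Rightarrow> real set) \<Rightarrow> real \<Rightarrow> 'a set" where
  "small_values X \<Phi> \<epsilon> = {x \<in> topspace X. \<Phi> x \<subseteq> ball 0 \<epsilon>}"

lemma small_values_in_nbhds_set:
  assumes "A \<subseteq> topspace X" "A \<noteq> {}" "\<Phi> \<in> zero_nbhd X A \<epsilon>" "small_values X \<Phi> \<epsilon> \<noteq> topspace X"
  shows "small_values X \<Phi> \<epsilon> \<in> nbhds_set X A"
proof -
  have "openin X (small_values X \<Phi> \<epsilon>)"
    using assms(3) by (auto simp: small_values_def zero_nbhd_def MC_def cusco_map_def)
  moreover have "A \<subseteq> small_values X \<Phi> \<epsilon>"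
    using assms(1,3) by (fastforce simp: small_values_def zero_nbhd_def)
  ultimately show ?thesis
    using assms(2,4) by (auto simp: nbhds_set_def proper_opens_def)
qed

text \<open>A move \<open>N\<close> of One is a set of the form \<open>\<N>\<^sub>X(A)\<close>, from which a suitable \<open>A\<close> has to be chosen.
  If \<open>\<Phi>\<close> is small on all of \<open>X\<close>, Two answers with an arbitrary element of \<open>N\<close>. This spoils nothing:
  the answer serves only to show that \<open>\<Phi>\<close> is small on each \<open>B \<in> \<B>\<close> that it contains, and here
  \<open>\<Phi>\<close> is small on \<open>B\<close> whatever the answer is.\<close>

lemma zero_nbhds_le_II_nbhds_family:
  assumes X: "t1_space X"
    and \<A>: "ideal_of_closed_sets X \<A>"
    and \<B>: "ideal_of_closed_sets X \<B>"
  shows "(nbhds_pt (MC_space X \<A>) (zero_map X), - Gamma_pt (MC_space X \<B>) (zero_map X))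
           \<le>\<^sub>I\<^sub>I (nbhds_family X \<A>, - Gamma_cover X \<B>)"
proof -
  define r :: "nat \<Rightarrow> real" where "r n = (1/2) ^ n" for n
  have r: "r n > 0" for n
    by (simp add: r_def)
  have r_small: "\<forall>\<^sub>F n in sequentially. r n < \<epsilon>" if "\<epsilon> > 0" for \<epsilon>
    unfolding r_def by (rule order_tendstoD(2)[OF LIMSEQ_realpow_zero that]) auto
  define base where "base N = (SOME A. A \<in> \<A> \<and> N = nbhds_set X A)" for N
  have base: "base N \<in> \<A> \<and> N = nbhds_set X (base N)" if "N \<in> nbhds_family X \<A>" for N
    unfolding base_def by (rule someI_ex) (use that in \<open>auto simp: nbhds_family_def\<close>)
  have base_sub: "base N \<subseteq> topspace X" "base N \<noteq> {}" if "N \<in> nbhds_family X \<A>" for N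
    using base[OF that] \<A> by (auto simp: ideal_of_closed_sets_def closedin_def)
  define t1 where "t1 n N = zero_nbhd X (base N) (r n)" for n N
  define t2 where "t2 n N \<Phi> = (if small_values X \<Phi> (r n) = topspace X then SOME U. U \<in> N
      else small_values X \<Phi> (r n))" for n N \<Phi>
  have t2: "t2 n N \<Phi> \<in> N" if N: "N \<in> nbhds_family X \<A>" and \<Phi>: "\<Phi> \<in> t1 n N" for n N \<Phi>
  proof (cases "small_values X \<Phi> (r n) = topspace X")
    case True
    have "N \<noteq> {}"
      using nbhds_set_nonempty[OF X \<A>] base[OF N] by metis
    with True show ?thesis
      by (simp add: t2_def some_in_eq)
  next
    case False
    then have "small_values X \<Phi> (r n) \<in> nbhds_set X (base N)"
      using base_sub[OF N] \<Phi> by (intro small_values_in_nbhds_set) (auto simp: t1_def)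
    with False show ?thesis
      using base[OF N] by (simp add: t2_def)
  qed
  show ?thesis
  proof (rule game_le_II_translation[of _ t1 _ t2])
    show "t1 n N \<in> nbhds_pt (MC_space X \<A>) (zero_map X)" if "N \<in> nbhds_family X \<A>" for n N
      unfolding t1_def using base[OF that] r by (intro zero_nbhd_in_nbhds_pt \<A>) auto
  next
    fix N :: "nat \<Rightarrow> 'a set set" and s
    assume N: "\<And>n. N n \<in> nbhds_family X \<A>" and s: "\<And>n. s n \<in> t1 n (N n)"
      and not_conv: "s \<in> - Gamma_pt (MC_space X \<B>) (zero_map X)"
    have sMC: "s n \<in> MC X" for n
      using s[of n] by (auto simp: t1_def zero_nbhd_def)
    have ne: "topspace X \<noteq> {}"
      using base_sub[OF N] by blast
    show "(\<lambda>n. t2 n (N n) (s n)) \<in> - Gamma_cover X \<B>"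
    proof
      assume cover: "(\<lambda>n. t2 n (N n) (s n)) \<in> Gamma_cover X \<B>"
      have "\<forall>\<^sub>F n in sequentially. \<forall>x\<in>B. s n x \<subseteq> ball 0 \<epsilon>" if "B \<in> \<B>" "\<epsilon> > 0" for B \<epsilon>
      proof -
        have "B \<subseteq> topspace X"
          using \<B> \<open>B \<in> \<B>\<close> by (auto simp: ideal_of_closed_sets_def closedin_def)
        have "\<forall>\<^sub>F n in sequentially. B \<subseteq> t2 n (N n) (s n)"
          using cover \<open>B \<in> \<B>\<close> by (simp add: Gamma_cover_def)
        then show ?thesis
          using r_small[OF \<open>\<epsilon> > 0\<close>]
        proof eventually_elim
          case (elim n)
          then have "B \<subseteq> small_values X (s n) (r n)"
            using \<open>B \<subseteq> topspace X\<close> by (auto simp: t2_def split: if_splits)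
          then show ?case
            using elim(2) by (fastforce simp: small_values_def)
        qed
      qed
      then have "limitin (MC_space X \<B>) s (zero_map X) sequentially"
        using sMC by (intro limitin_zero_mapI \<B> ne)
      then show False
        using not_conv sMC by (auto simp: Gamma_pt_def)
    qed
  qed (use t2 in auto)
qed


section \<open>Comparing the three games\<close>

lemma Gamma_pt_imp_range_in_Omega_pt:
  assumes "s \<in> Gamma_pt Y y"
  shows "range s \<in> Omega_pt Y y"
proof -
  have "y \<in> Y closure_of range s"
    unfolding in_closure_of
  proof (intro conjI allI impI)
    show "y \<in> topspace Y"
      using assms by (auto simp: Gamma_pt_def limitin_def)
    fix U assume "y \<in> U \<and> openin Y U"
    then have "\<forall>\<^sub>F n in sequentially. s n \<in> U"
      using assms by (auto simp: Gamma_pt_def limitin_def)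
    then have "\<exists>n. s n \<in> U"
      by (rule eventually_happens'[OF sequentially_bot])
    then show "\<exists>z. z \<in> range s \<and> z \<in> U"
      by blast
  qed
  then show ?thesis
    using assms by (simp add: Gamma_pt_def Omega_pt_def)
qed

theorem proposition36:
  fixes X :: "'a topology" and \<A> \<B> :: "'a set set"
  assumes "Hausdorff_space X"
    and "ideal_of_closed_sets X \<A>"
    and "ideal_of_closed_sets X \<B>"
  shows "G1 (nbhds_pt (MC_space X \<A>) (zero_map X)) (- Omega_pt (MC_space X \<B>) (zero_map X))
           \<le>\<^sub>I\<^sub>I G1_seq (nbhds_pt (MC_space X \<A>) (zero_map X)) (- Gamma_pt (MC_space X \<B>) (zero_map X))
       \<and> G1_seq (nbhds_pt (MC_space X \<A>) (zero_map X)) (- Gamma_pt (MC_space X \<B>) (zero_map X))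
           \<le>\<^sub>I\<^sub>I G1_seq (nbhds_family X \<A>) (- Gamma_cover X \<B>)"
proof
  show "G1 (nbhds_pt (MC_space X \<A>) (zero_map X)) (- Omega_pt (MC_space X \<B>) (zero_map X))
      \<le>\<^sub>I\<^sub>I G1_seq (nbhds_pt (MC_space X \<A>) (zero_map X)) (- Gamma_pt (MC_space X \<B>) (zero_map X))"
    unfolding G1_def G1_seq_def
    by (rule game_le_II_mono) (auto dest: Gamma_pt_imp_range_in_Omega_pt)
  show "G1_seq (nbhds_pt (MC_space X \<A>) (zero_map X)) (- Gamma_pt (MC_space X \<B>) (zero_map X))
      \<le>\<^sub>I\<^sub>I G1_seq (nbhds_family X \<A>) (- Gamma_cover X \<B>)"
    unfolding G1_seq_def
    using Hausdorff_imp_t1_space[OF assms(1)] assms(2,3) by (rule zero_nbhds_le_II_nbhds_family)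
qed

end
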